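(* Let $0<q<1$, $k\ge1$, and let \[ \Phi(z_1,\cdots,z_k):=\sum_{n_1,\cdots,n_k=0}^{\infty}c(n_1,\cdots,n_k)z_1^{n_1}\cdots z_k^{n_k}, \] where $\{c(n_1,\cdots,n_k)\}$ is a sequence of complex numbers such that the series converges absolutely and uniformly in a certain region of $\mathbb{C}^k$, and let $(z_1,\dots,z_k)$ lie in this region. Let $\gamma_j,\eta_j,\lambda_j,\nu_j\in\mathbb{C}$ satisfy $\min\{\Re(\nu_j),\Re(\lambda_j),\Re(\gamma_j+\eta_j-\lambda_j-\nu_j)\}>0$ and $q^{\gamma_j},q^{\eta_j}\notin\{q^{-n}:n\in\mathbb{Z}_{\ge0}\}$ for $j=1,\dots,k$. Then \[ \sum_{n_1,\cdots,n_k=0}^{\infty}c(n_1,\cdots,n_k)\prod_{j=1}^{k}\frac{(q^{\nu_j},q^{\lambda_j};q)_{n_j}}{(q^{\gamma_j},q^{\eta_j};q)_{n_j}}z_j^{n_j} =\int_{[0,1]^k}\Phi(z_1t_1,\cdots,z_kt_k)\prod_{j=1}^{k}\mathrm{d}\mu_{\eta_j-\lambda_j,\;\gamma_j-\lambda_j,\;\gamma_j-\lambda_j+\eta_j-\nu_j,\;\nu_j}(t_j;q). \]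
   Context: $(a;q)_n=\prod_{j=0}^{n-1}(1-aq^j)$, $(a;q)_\infty=\prod_{j\ge0}(1-aq^j)$, $(a_1,\dots,a_m;q)_n=(a_1;q)_n\cdots(a_m;q)_n$. The $k$-dimensional $q$-integral is $\int_{[0,1]^k}f(\mathbf{x})\,\mathrm{d}_q\mathbf{x}=(1-q)^k\sum_{n_1,\dots,n_k\ge0}f(q^{n_1},\dots,q^{n_k})q^{n_1+\cdots+n_k}$. $\Gamma_q(x)=\frac{(q;q)_\infty}{(q^x;q)_\infty}(1-q)^{1-x}$. The basic hypergeometric series is \[ {}_{r}\phi_{s}\left[\begin{matrix}a_1,\cdots,a_r\\ b_1,\cdots,b_s\end{matrix};q,z\right]=\sum_{n=0}^{\infty}\frac{(a_1,\cdots,a_r;q)_n}{(b_1,\cdots,b_s,q;q)_n}\Big((-1)^nq^{\binom n2}\Big)^{1+s-r}z^n . \] The $q$-hypergeometric measure is, for $\min\{\Re(\eta),\Re(\gamma),\Re(\eta+\gamma-\alpha-\beta)\}>0$, \[ \mathrm{d}\mu_{\alpha,\beta,\gamma,\eta}(t;q)=\frac{\Gamma_q(\eta+\gamma-\alpha)\Gamma_q(\eta+\gamma-\beta)}{\Gamma_q(\eta)\Gamma_q(\gamma)\Gamma_q(\eta+\gamma-\alpha-\beta)}\,t^{\eta-1}\frac{(tq;q)_\infty}{(tq^{\gamma};q)_\infty}\,{}_{3}\phi_{1}\left[\begin{matrix}q^{\alpha},q^{\beta},t^{-1}\\ q^{\gamma}\end{matrix};q,tq^{\gamma-\alpha-\beta}\right]\mathrm{d}_qt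 \] (at the points $t=q^n$, $n\ge 0$, of the $q$-integral the ${}_3\phi_1$ terminates). *)

theory Defs
  imports "HOL-Analysis.Analysis"
begin

definition qpoch :: "complex \<Rightarrow> real \<Rightarrow> nat \<Rightarrow> complex" where
  "qpoch a q n = (\<Prod>j<n. 1 - a * of_real q ^ j)"

definition qpoch_inf :: "complex \<Rightarrow> real \<Rightarrow> complex" where
  "qpoch_inf a q = (\<Prod>j. 1 - a * of_real q ^ j)"

definition qpochs :: "complex list \<Rightarrow> real \<Rightarrow> nat \<Rightarrow> complex" where
  "qpochs as q n = (\<Prod>a\<leftarrow>as. qpoch a q n)"

definition q_Gamma :: "real \<Rightarrow> complex \<Rightarrow> complex" where
  "q_Gamma q x =
     qpoch_inf (of_real q) q / qpoch_inf (of_real q powr x) q * of_real (1 - q) powr (1 - x)"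

text \<open>The series ${}_r\phi_s$ with $r$ and $s$ the lengths of the two parameter lists;
  the exponent $1 + s - r$ may be negative.\<close>

definition basic_hypergeometric ::
    "complex list \<Rightarrow> complex list \<Rightarrow> real \<Rightarrow> complex \<Rightarrow> complex" where
  "basic_hypergeometric as bs q z =
     (\<Sum>n. qpochs as q n / qpochs (bs @ [of_real q]) q n
          * ((-1) ^ n * of_real q ^ (n choose 2)) powi (1 + int (length bs) - int (length as))
          * z ^ n)"

text \<open>The density of $\mathrm{d}\mu_{\alpha,\beta,\gamma,\eta}(t;q)$ with respect to
  $\mathrm{d}_q t$, for $t > 0$.\<close>

definition q_hyp_density ::
    "complex \<Rightarrow> complex \<Rightarrow> complex \<Rightarrow> complex \<Rightarrow> real \<Rightarrow> real \<Rightarrow> complex" where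
  "q_hyp_density \<alpha> \<beta> \<gamma> \<eta> q t =
     q_Gamma q (\<eta> + \<gamma> - \<alpha>) * q_Gamma q (\<eta> + \<gamma> - \<beta>)
       / (q_Gamma q \<eta> * q_Gamma q \<gamma> * q_Gamma q (\<eta> + \<gamma> - \<alpha> - \<beta>))
     * of_real t powr (\<eta> - 1)
     * (qpoch_inf (of_real t * of_real q) q / qpoch_inf (of_real t * of_real q powr \<gamma>) q)
     * basic_hypergeometric
         [of_real q powr \<alpha>, of_real q powr \<beta>, inverse (of_real t)] [of_real q powr \<gamma>]
         q (of_real t * of_real q powr (\<gamma> - \<alpha> - \<beta>))"

text \<open>The $k$-dimensional $q$-integral over $[0,1]^k$, with $k$ the cardinality of the index type.
  As the unordered sum takes the value 0 when it does not converge, convergence is a separate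
  predicate.\<close>

definition q_integrand_term :: "real \<Rightarrow> (real ^ 'k \<Rightarrow> complex) \<Rightarrow> ('k::finite \<Rightarrow> nat) \<Rightarrow> complex" where
  "q_integrand_term q f n = f (\<chi> j. q ^ n j) * of_real (q ^ (\<Sum>j\<in>UNIV. n j))"

definition q_integrable :: "real \<Rightarrow> (real ^ 'k::finite \<Rightarrow> complex) \<Rightarrow> bool" where
  "q_integrable q f \<longleftrightarrow> q_integrand_term q f summable_on UNIV"

definition q_integral :: "real \<Rightarrow> (real ^ 'k::finite \<Rightarrow> complex) \<Rightarrow> complex" where
  "q_integral q f = of_real ((1 - q) ^ CARD('k)) * (\<Sum>\<^sub>\<infinity>n. q_integrand_term q f n)"

definition power_series_term ::
    "(('k::finite \<Rightarrow> nat) \<Rightarrow> complex) \<Rightarrow> complex ^ 'k \<Rightarrow> ('k \<Rightarrow> nat) \<Rightarrow> complex" where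
  "power_series_term c z n = c n * (\<Prod>j\<in>UNIV. (z $ j) ^ n j)"

definition power_series :: "(('k::finite \<Rightarrow> nat) \<Rightarrow> complex) \<Rightarrow> complex ^ 'k \<Rightarrow> complex" where
  "power_series c z = (\<Sum>\<^sub>\<infinity>n. power_series_term c z n)"

end

theory Submission
  imports Defs
begin

text \<open>The moment of order \<open>n\<close> of \<open>d\<mu>\<close> with parameters
  \<open>\<eta> - \<lambda>, \<gamma> - \<lambda>, \<gamma> - \<lambda> + \<eta> - \<nu>, \<nu>\<close> is
  \<open>(q\<^sup>\<nu>, q\<^sup>\<lambda>; q)\<^sub>n / (q\<^sup>\<gamma>, q\<^sup>\<eta>; q)\<^sub>n\<close>: at \<open>t = q\<^sup>m\<close> the \<open>3\<phi>1\<close> is a finite sum over \<open>j \<le> m\<close>,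
  and after interchanging the sums the one over \<open>m - j\<close> is evaluated by the \<open>q\<close>-binomial theorem
  and the one over \<open>j\<close> by the \<open>q\<close>-Gauss sum. Since the powers of \<open>t\<close> are at most 1 on the
  lattice, absolute convergence of \<open>\<Phi>\<close> at \<open>z\<close> justifies integrating \<open>\<Phi>\<close> term by term.

  The \<open>q\<close>-Gauss sum is proved by iterating its contiguous relation in \<open>z \<mapsto> q z\<close>, which needs no
  restriction on the numerator parameters, unlike the route through Heine's transformation;
  the \<open>q\<close>-binomial theorem is the case \<open>b = 0\<close>.\<close>

section \<open>Finite q-Pochhammer symbols and a geometric majorant\<close>

lemma qpoch_0 [simp]: "qpoch a q 0 = 1"
  by (simp add: qpoch_def)

lemma qpoch_Suc: "qpoch a q (Suc n) = qpoch a q n * (1 - a * of_real q ^ n)"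
  by (simp add: qpoch_def)

lemma qpoch_zero [simp]: "qpoch 0 q n = 1"
  by (simp add: qpoch_def)

lemma qpoch_add: "qpoch a q (m + n) = qpoch a q m * qpoch (a * of_real q ^ m) q n"
  by (induction n) (simp_all add: qpoch_Suc power_add mult_ac)

lemma qpoch_nonzero: "(\<And>j. a * of_real q ^ j \<noteq> 1) \<Longrightarrow> qpoch a q n \<noteq> 0"
  unfolding qpoch_def by (metis (no_types, lifting) finite_lessThan prod_zero_iff right_minus_eq)

text \<open>Up to a constant factor this is the majorant of the double series in
  \<open>has_sum_q_hyp_kernel\<close>.\<close>

lemma summable_on_geometric_Times:
  fixes x y :: real
  assumes "0 \<le> x" "x < 1" "0 \<le> y" "y < 1"
  shows "(\<lambda>(i, j). x ^ i * y ^ j) summable_on (UNIV :: (nat \<times> nat) set)"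
proof -
  have geo: "((\<lambda>i. u ^ i) has_sum (1 / (1 - u))) UNIV" if "0 \<le> u" "u < 1" for u :: real
    using that geometric_sums[of u] by (intro sums_nonneg_imp_has_sum) auto
  have "(\<lambda>(i, j). x ^ i * y ^ j) summable_on (SIGMA i:UNIV. UNIV)"
  proof (rule summable_on_SigmaI)
    show "((\<lambda>j. case (i, j) of (i, j) \<Rightarrow> x ^ i * y ^ j) has_sum (x ^ i * (1 / (1 - y)))) UNIV" for i :: nat
      using has_sum_cmult_right[OF geo[of y]] assms by simp
    show "(\<lambda>i. x ^ i * (1 / (1 - y))) summable_on UNIV"
      using has_sum_imp_summable[OF geo[of x]] assms by (intro summable_on_cmult_left) auto
  qed (use assms in auto)
  thus ?thesis by simp
qed

section \<open>Infinite q-Pochhammer products and bounds\<close>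

context
  fixes q :: real
  assumes q: "0 < q" "q < 1"
begin

lemma convergent_prod_qpoch: "convergent_prod (\<lambda>j. 1 - a * of_real q ^ j :: complex)"
proof (intro abs_convergent_prod_imp_convergent_prod summable_imp_abs_convergent_prod)
  have "summable (\<lambda>j. norm a * q ^ j)"
    using q by (intro summable_mult summable_geometric) auto
  thus "summable (\<lambda>j. norm (1 - a * of_real q ^ j - 1))"
    using q by (simp add: norm_mult norm_power)
qed

lemma qpoch_LIMSEQ: "(\<lambda>n. qpoch a q n) \<longlonglongrightarrow> qpoch_inf a q"
proof -
  have "(\<lambda>n. qpoch a q (Suc n)) \<longlonglongrightarrow> qpoch_inf a q"
    using convergent_prod_LIMSEQ[OF convergent_prod_qpoch[of a]]
    by (simp add: qpoch_def qpoch_inf_def lessThan_Suc_atMost)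
  thus ?thesis by (simp add: filterlim_sequentially_Suc)
qed

lemma qpoch_inf_nonzero: "(\<And>j. a * of_real q ^ j \<noteq> 1) \<Longrightarrow> qpoch_inf a q \<noteq> 0"
  unfolding qpoch_inf_def by (rule prodinf_nonzero[OF convergent_prod_qpoch]) (metis right_minus_eq)

lemma qpoch_inf_split: "qpoch_inf a q = qpoch a q n * qpoch_inf (a * of_real q ^ n) q"
proof (rule LIMSEQ_unique)
  show "(\<lambda>m. qpoch a q (n + m)) \<longlonglongrightarrow> qpoch_inf a q"
    using LIMSEQ_ignore_initial_segment[OF qpoch_LIMSEQ, of a n] by (simp add: add.commute)
  show "(\<lambda>m. qpoch a q (n + m)) \<longlonglongrightarrow> qpoch a q n * qpoch_inf (a * of_real q ^ n) q"
    unfolding qpoch_add by (intro tendsto_intros qpoch_LIMSEQ)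
qed

lemma qpoch_bounded: obtains M where "M > 0" "\<And>n. norm (qpoch a q n) \<le> M"
  using convergent_imp_Bseq[OF convergentI[OF qpoch_LIMSEQ[of a]]] unfolding Bseq_def by blast

text \<open>Without a vanishing factor the infinite product is nonzero, so the reciprocals converge
  as well and are therefore bounded.\<close>

lemma inverse_qpoch_bounded:
  assumes "\<And>j. a * of_real q ^ j \<noteq> 1"
  obtains M where "M > 0" "\<And>n. norm (inverse (qpoch a q n)) \<le> M"
  using convergent_imp_Bseq[OF convergentI[OF
      tendsto_inverse[OF qpoch_LIMSEQ[of a] qpoch_inf_nonzero[OF assms]]]]
  unfolding Bseq_def by blast

lemma mult_power_ne_1:
  assumes "norm a < 1"
  shows "a * of_real q ^ j \<noteq> (1 :: complex)"
proof
  assume "a * of_real q ^ j = 1"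
  hence "norm a * q ^ j = 1"
    using q by (metis abs_of_pos norm_mult norm_of_real norm_one norm_power)
  moreover have "norm a * q ^ j \<le> norm a * 1"
    using q by (intro mult_left_mono power_le_one) auto
  ultimately show False using assms by simp
qed

lemma q_mult_power_ne_1: "of_real q * of_real q ^ j \<noteq> (1 :: complex)"
  using q by (intro mult_power_ne_1) auto

section \<open>The q-Gauss sum and the q-binomial theorem\<close>

text \<open>The summand of 2phi1(a, b; c; q, z) under the Gauss condition z = c / (a b), with c
  eliminated as \<open>a * b * z\<close>. This form involves no division by \<open>a\<close> or
  \<open>b\<close>, so either may be 0.\<close>

definition gauss_term :: "complex \<Rightarrow> complex \<Rightarrow> complex \<Rightarrow> nat \<Rightarrow> complex" where
  "gauss_term a b z j =
     qpoch a q j * qpoch b q j / (qpoch (of_real q) q j * qpoch (a * b * z) q j) * z ^ j"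

text \<open>The constant \<open>K\<close> is uniform in \<open>n\<close>, as the limit of the
  iteration in \<open>q_gauss_sum\<close> requires.\<close>

lemma gauss_term_bound:
  assumes "\<And>j. a * b * z * of_real q ^ j \<noteq> 1"
  obtains K where "K > 0" "\<And>n j. norm (gauss_term a b (z * of_real q ^ n) j) \<le> K * (norm z * q ^ n) ^ j"
proof -
  obtain Ma where Ma: "Ma > 0" "\<And>n. norm (qpoch a q n) \<le> Ma" using qpoch_bounded by blast
  obtain Mb where Mb: "Mb > 0" "\<And>n. norm (qpoch b q n) \<le> Mb" using qpoch_bounded by blast
  obtain Mc where Mc: "Mc > 0" "\<And>n. norm (qpoch (a * b * z) q n) \<le> Mc" using qpoch_bounded by blast
  obtain Nq where Nq: "Nq > 0" "\<And>n. norm (inverse (qpoch (of_real q) q n)) \<le> Nq"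
    using inverse_qpoch_bounded[OF q_mult_power_ne_1] by blast
  obtain Nc where Nc: "Nc > 0" "\<And>n. norm (inverse (qpoch (a * b * z) q n)) \<le> Nc"
    using inverse_qpoch_bounded[OF assms] by blast
  show thesis
  proof
    show "Ma * Mb * (Nq * (Nc * Mc)) > 0" using Ma Mb Mc Nq Nc by simp
    fix n j
    have nz: "qpoch (a * b * z) q n \<noteq> 0" by (rule qpoch_nonzero[OF assms])
    \<comment> \<open>The denominator parameter moves with \<open>n\<close>. Writing its symbol as a
      quotient of two symbols with the fixed parameter \<open>a * b * z\<close> gives the bound
      \<open>Nc * Mc\<close> for all \<open>n\<close> and \<open>j\<close>.\<close>
    have eq: "inverse (qpoch (a * b * (z * of_real q ^ n)) q j)
        = inverse (qpoch (a * b * z) q (n + j)) * qpoch (a * b * z) q n"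
      using nz unfolding qpoch_add by (simp add: mult.assoc)
    have "gauss_term a b (z * of_real q ^ n) j = qpoch a q j * qpoch b q j *
        (inverse (qpoch (of_real q) q j) * (inverse (qpoch (a * b * z) q (n + j)) * qpoch (a * b * z) q n))
        * (z * of_real q ^ n) ^ j"
      unfolding gauss_term_def eq[symmetric] by (simp add: divide_inverse)
    also have "norm \<dots> = norm (qpoch a q j) * norm (qpoch b q j) *
        (norm (inverse (qpoch (of_real q) q j)) *
         (norm (inverse (qpoch (a * b * z) q (n + j))) * norm (qpoch (a * b * z) q n)))
        * (norm z * q ^ n) ^ j"
      using q by (simp only: norm_mult norm_power norm_of_real abs_of_pos)
    also have "\<dots> \<le> Ma * Mb * (Nq * (Nc * Mc)) * (norm z * q ^ n) ^ j"
      using q Ma Mb Mc Nq Nc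
      by (intro mult_right_mono mult_mono mult_nonneg_nonneg) (auto intro: less_imp_le)
    finally show "norm (gauss_term a b (z * of_real q ^ n) j)
        \<le> Ma * Mb * (Nq * (Nc * Mc)) * (norm z * q ^ n) ^ j" .
  qed
qed

lemma summable_norm_gauss_term:
  assumes "norm z < 1" "\<And>j. a * b * z * of_real q ^ j \<noteq> 1"
  shows "summable (\<lambda>j. norm (gauss_term a b z j))"
proof -
  obtain K where K: "K > 0" "\<And>n j. norm (gauss_term a b (z * of_real q ^ n) j) \<le> K * (norm z * q ^ n) ^ j"
    using gauss_term_bound[OF assms(2)] by blast
  have "summable (\<lambda>j. K * norm z ^ j)"
    using assms(1) by (intro summable_mult summable_geometric) auto
  thus ?thesis
    by (rule summable_comparison_test'[where N = 0]) (use K(2)[of 0] in simp)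
qed

text \<open>The difference of the two sides telescopes with certificate
  \<open>- (1 - q ^ j) * (1 - a * b * z) * gauss_term a b z j\<close>.\<close>

lemma gauss_term_contiguous:
  assumes z: "norm z < 1" and ne: "\<And>j. a * b * z * of_real q ^ j \<noteq> 1"
  shows "(1 - z) * (1 - a * b * z) * suminf (gauss_term a b z)
       = (1 - a * z) * (1 - b * z) * suminf (gauss_term a b (z * of_real q))"
proof -
  define Q where "Q = complex_of_real q"
  define t where "t = gauss_term a b z"
  define c where "c = a * b * z"
  have cne: "1 - c * Q ^ j \<noteq> 0" for j using ne[of j] by (simp add: c_def Q_def)
  have qne: "1 - Q * Q ^ j \<noteq> 0" for j
    using q_mult_power_ne_1[of j] by (metis Q_def right_minus_eq)
  have Suc_t: "t (Suc j) * ((1 - Q * Q ^ j) * (1 - c * Q ^ j))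
                = t j * ((1 - a * Q ^ j) * (1 - b * Q ^ j) * z)" for j
    using cne[of j] qne[of j]
    by (simp add: t_def gauss_term_def qpoch_Suc c_def Q_def)
  \<comment> \<open>Splitting off the first or the last factor of \<open>qpoch c q (Suc j)\<close>
    relates the parameters \<open>c\<close> and \<open>c * Q\<close>.\<close>
  have shift: "gauss_term a b (z * Q) j * (1 - c * Q ^ j) = t j * Q ^ j * (1 - c)" for j
  proof -
    have "qpoch c q (Suc j) = (1 - c) * qpoch (c * Q) q j"
      using qpoch_add[of c q 1 j] by (simp add: qpoch_Suc Q_def)
    hence *: "qpoch c q j * (1 - c * Q ^ j) = (1 - c) * qpoch (c * Q) q j"
      by (simp add: qpoch_Suc Q_def)
    have nz: "qpoch c q j \<noteq> 0" unfolding c_def by (rule qpoch_nonzero[OF ne])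
    with cne[of j] * have nz': "qpoch (c * Q) q j \<noteq> 0" by auto
    have "gauss_term a b (z * Q) j * (1 - c * Q ^ j)
        = qpoch a q j * qpoch b q j / qpoch Q q j * z ^ j * Q ^ j
           * ((1 - c * Q ^ j) / qpoch (c * Q) q j)"
      by (simp add: gauss_term_def c_def Q_def power_mult_distrib mult.assoc)
    also have "(1 - c * Q ^ j) / qpoch (c * Q) q j = (1 - c) / qpoch c q j"
      using * nz nz' by (simp add: field_simps)
    finally show ?thesis by (simp add: t_def gauss_term_def c_def Q_def)
  qed
  define G where "G j = - ((1 - Q ^ j) * t j) * (1 - c)" for j
  have tele: "(1 - z) * (1 - c) * t j - (1 - a * z) * (1 - b * z) * gauss_term a b (z * Q) j
      = G (Suc j) - G j" for j
  proof -
    \<comment> \<open>Multiplied by \<open>1 - c * Q ^ j\<close>, both series terms and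
      \<open>G (Suc j)\<close> become multiples of \<open>t j\<close>, by \<open>shift\<close> and
      \<open>Suc_t\<close>; what remains is a polynomial identity.\<close>
    have "((1 - z) * (1 - c) * t j - (1 - a * z) * (1 - b * z) * gauss_term a b (z * Q) j) * (1 - c * Q ^ j)
        = (1 - z) * (1 - c) * t j * (1 - c * Q ^ j)
          - (1 - a * z) * (1 - b * z) * (gauss_term a b (z * Q) j * (1 - c * Q ^ j))"
      by (simp add: algebra_simps)
    also have "\<dots> = (1 - z) * (1 - c) * t j * (1 - c * Q ^ j)
          - (1 - a * z) * (1 - b * z) * (t j * Q ^ j * (1 - c))"
      by (simp only: shift)
    also have "\<dots> = - (1 - c) * (t j * ((1 - a * Q ^ j) * (1 - b * Q ^ j) * z))
          + (1 - Q ^ j) * t j * (1 - c) * (1 - c * Q ^ j)"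
      unfolding c_def by algebra
    also have "\<dots> = (G (Suc j) - G j) * (1 - c * Q ^ j)"
      unfolding Suc_t[symmetric] G_def by (simp add: algebra_simps)
    finally show ?thesis using cne[of j] by simp
  qed
  have t: "summable t"
    unfolding t_def by (intro summable_norm_cancel[OF summable_norm_gauss_term] z ne)
  have ne': "a * b * (z * Q) * of_real q ^ j \<noteq> 1" for j
    using ne[of "Suc j"] by (simp add: Q_def mult_ac)
  have "norm (z * Q) < 1"
    using z q mult_strict_mono[of "norm z" 1 q 1] by (simp add: Q_def norm_mult)
  hence t': "summable (gauss_term a b (z * Q))"
    by (intro summable_norm_cancel[OF summable_norm_gauss_term] ne')
  have "(\<lambda>j. Q ^ j) \<longlonglongrightarrow> 0" unfolding Q_def using q by (intro LIMSEQ_power_zero) auto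
  hence "G \<longlonglongrightarrow> - ((1 - 0) * 0) * (1 - c)"
    unfolding G_def
    by (intro tendsto_mult tendsto_minus tendsto_diff tendsto_const summable_LIMSEQ_zero[OF t])
  \<comment> \<open>The sum is 0: \<open>G\<close> tends to 0 with the summands, and
    \<open>G 0\<close> vanishes through its factor \<open>1 - Q ^ 0\<close>.\<close>
  hence "(\<lambda>j. G (Suc j) - G j) sums (0 - G 0)"
    by (intro telescope_sums) simp
  moreover have "(\<lambda>j. G (Suc j) - G j) sums ((1 - z) * (1 - c) * suminf t
      - (1 - a * z) * (1 - b * z) * suminf (gauss_term a b (z * Q)))"
    unfolding tele[symmetric] by (intro sums_diff sums_mult summable_sums t t')
  ultimately show ?thesis
    by (auto dest: sums_unique2 simp: G_def c_def t_def Q_def)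
qed

text \<open>After \<open>n\<close> uses of the contiguous relation the prefactors have accumulated
  to finite Pochhammer symbols and the argument is z q^n. As \<open>n\<close> grows, the symbols
  tend to infinite products and the remaining series to its initial term 1.\<close>

theorem q_gauss_sum:
  assumes z: "norm z < 1" and ne: "\<And>j. a * b * z * of_real q ^ j \<noteq> 1"
  shows "(gauss_term a b z has_sum
           (qpoch_inf (a * z) q * qpoch_inf (b * z) q
             / (qpoch_inf (a * b * z) q * qpoch_inf z q))) UNIV"
proof -
  define F where "F n = suminf (gauss_term a b (z * of_real q ^ n))" for n
  have z_n: "norm (z * of_real q ^ n) < 1" for n
  proof -
    have "norm z * q ^ n \<le> norm z * 1" using q by (intro mult_left_mono power_le_one) auto
    thus ?thesis using z q by (simp add: norm_mult norm_power)
  qed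
  have ne_n: "a * b * (z * of_real q ^ n) * of_real q ^ j \<noteq> 1" for n j
    using ne[of "n + j"] by (simp add: power_add mult_ac)
  have iter: "qpoch z q n * qpoch (a * b * z) q n * F 0 = qpoch (a * z) q n * qpoch (b * z) q n * F n" for n
  proof (induction n)
    case (Suc n)
    let ?w = "z * of_real q ^ n"
    have "qpoch z q (Suc n) * qpoch (a * b * z) q (Suc n) * F 0
        = (qpoch z q n * qpoch (a * b * z) q n * F 0) * ((1 - ?w) * (1 - a * b * ?w))"
      by (simp add: qpoch_Suc mult_ac)
    also have "\<dots> = qpoch (a * z) q n * qpoch (b * z) q n * ((1 - ?w) * (1 - a * b * ?w) * F n)"
      unfolding Suc.IH by (simp add: mult_ac)
    also have "(1 - ?w) * (1 - a * b * ?w) * F n = (1 - a * ?w) * (1 - b * ?w) * F (Suc n)"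
      unfolding F_def using gauss_term_contiguous[OF z_n ne_n, of n] by (simp add: mult_ac)
    finally show ?case by (simp add: qpoch_Suc mult_ac)
  qed simp
  obtain K where K: "K > 0" "\<And>n j. norm (gauss_term a b (z * of_real q ^ n) j) \<le> K * (norm z * q ^ n) ^ j"
    using gauss_term_bound[OF ne] by blast
  define L where "L = (\<Sum>j. K * norm z ^ j)"
  \<comment> \<open>The term of index 0 is 1, and each later one carries a factor
    \<open>q ^ n\<close>; the other factors are dominated by a geometric series with sum
    \<open>L\<close>.\<close>
  have F_bound: "norm (F n - 1) \<le> L * q ^ n" for n
  proof -
    let ?t = "gauss_term a b (z * of_real q ^ n)"
    have "summable ?t"
      by (intro summable_norm_cancel[OF summable_norm_gauss_term] z_n ne_n)
    hence "F n - 1 = (\<Sum>j. ?t (Suc j))"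
      using suminf_split_head[of ?t] by (simp add: F_def gauss_term_def)
    also have "norm \<dots> \<le> (\<Sum>j. K * norm z ^ j * q ^ n)"
    proof (rule norm_suminf_le)
      fix j
      have "norm (?t (Suc j)) \<le> K * (norm z * q ^ n) ^ Suc j" by (rule K)
      also have "\<dots> = K * norm z ^ j * q ^ n * (norm z * (q ^ n) ^ j)"
        by (simp add: power_mult_distrib mult_ac)
      also have "\<dots> \<le> K * norm z ^ j * q ^ n * 1"
        using K z q by (intro mult_left_mono mult_le_one power_le_one) (auto intro: less_imp_le)
      finally show "norm (?t (Suc j)) \<le> K * norm z ^ j * q ^ n" by simp
    qed (use z in \<open>intro summable_mult summable_mult2 summable_geometric; simp\<close>)
    also have "\<dots> = L * q ^ n"
      unfolding L_def using z by (intro suminf_mult2[symmetric] summable_mult summable_geometric) simp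
    finally show ?thesis .
  qed
  have "(\<lambda>n. L * q ^ n) \<longlonglongrightarrow> 0"
    using q by (intro tendsto_mult_right_zero LIMSEQ_power_zero) auto
  hence "(\<lambda>n. F n - 1) \<longlonglongrightarrow> 0"
    by (rule Lim_null_comparison[rotated]) (intro always_eventually allI F_bound)
  hence F_lim: "F \<longlonglongrightarrow> 1" by (simp add: LIM_zero_iff)
  have "qpoch_inf z q * qpoch_inf (a * b * z) q * F 0 = qpoch_inf (a * z) q * qpoch_inf (b * z) q * 1"
  proof (rule LIMSEQ_unique)
    show "(\<lambda>n. qpoch z q n * qpoch (a * b * z) q n * F 0)
            \<longlonglongrightarrow> qpoch_inf z q * qpoch_inf (a * b * z) q * F 0"
      by (intro tendsto_mult tendsto_const qpoch_LIMSEQ)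
    show "(\<lambda>n. qpoch z q n * qpoch (a * b * z) q n * F 0)
            \<longlonglongrightarrow> qpoch_inf (a * z) q * qpoch_inf (b * z) q * 1"
      unfolding iter by (intro tendsto_mult qpoch_LIMSEQ F_lim)
  qed
  moreover have "qpoch_inf z q \<noteq> 0" by (intro qpoch_inf_nonzero mult_power_ne_1 z)
  moreover have "qpoch_inf (a * b * z) q \<noteq> 0" by (intro qpoch_inf_nonzero ne)
  ultimately have "F 0 = qpoch_inf (a * z) q * qpoch_inf (b * z) q
             / (qpoch_inf (a * b * z) q * qpoch_inf z q)"
    by (simp add: field_simps)
  moreover have "gauss_term a b z sums F 0"
    unfolding F_def
    using summable_sums[OF summable_norm_cancel[OF summable_norm_gauss_term[OF z ne]]] by simp
  ultimately show ?thesis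
    using norm_summable_imp_has_sum[OF summable_norm_gauss_term[OF z ne]] by simp
qed

corollary q_binomial_theorem:
  assumes "norm z < 1"
  shows "((\<lambda>i. qpoch a q i / qpoch (of_real q) q i * z ^ i) has_sum
           (qpoch_inf (a * z) q / qpoch_inf z q)) UNIV"
proof -
  have "qpoch_inf 0 q = 1" by (simp add: qpoch_inf_def)
  thus ?thesis
    using q_gauss_sum[of z a 0] assms by (simp add: gauss_term_def[abs_def])
qed

section \<open>The terminating 3phi1 at lattice points\<close>

text \<open>Each factor 1 - q^(i-m) equals -q^(i-m) (1 - q^(m-i)). The result is stated without
  quotients, with the power of \<open>of_real q ^ m\<close> that the argument of the 3phi1
  supplies.\<close>

lemma qpoch_inverse_power:
  assumes "j \<le> m"
  shows "qpoch (inverse (of_real q ^ m)) q j * qpoch (of_real q) q (m - j) * (of_real q ^ m) ^ j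
       = qpoch (of_real q) q m * ((-1) ^ j * of_real q ^ (j choose 2))"
  using assms
proof (induction j)
  case (Suc j)
  define Q where "Q = complex_of_real q"
  have Q: "Q \<noteq> 0" using q by (simp add: Q_def)
  \<comment> \<open>Here \<open>d\<close> is m - j - 1, so \<open>1 - Q * Q ^ d\<close> is the last
    factor of \<open>qpoch Q q (m - j)\<close>. By \<open>key\<close> the new factor on the left
    replaces it, up to \<open>- (Q ^ j)\<close>.\<close>
  obtain d where d: "m = j + Suc d" using le_Suc_ex[OF Suc.prems] by auto
  have key: "(1 - inverse (Q ^ m) * Q ^ j) * Q ^ m = - (Q ^ j) * (1 - Q * Q ^ d)"
    using Q by (simp add: d power_add field_simps)
  have IH: "qpoch (inverse (Q ^ m)) q j * (qpoch Q q d * (1 - Q * Q ^ d)) * (Q ^ m) ^ j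
       = qpoch Q q m * ((-1) ^ j * Q ^ (j choose 2))"
    using Suc by (simp add: Q_def d qpoch_Suc)
  have "qpoch (inverse (Q ^ m)) q (Suc j) * qpoch Q q d * (Q ^ m) ^ Suc j
      = qpoch (inverse (Q ^ m)) q j * qpoch Q q d * (Q ^ m) ^ j * ((1 - inverse (Q ^ m) * Q ^ j) * Q ^ m)"
    by (simp add: qpoch_Suc Q_def mult_ac)
  also have "\<dots> = (qpoch (inverse (Q ^ m)) q j * (qpoch Q q d * (1 - Q * Q ^ d)) * (Q ^ m) ^ j) * (- (Q ^ j))"
    unfolding key by (simp add: mult_ac)
  also have "\<dots> = qpoch Q q m * ((-1) ^ Suc j * Q ^ (Suc j choose 2))"
    unfolding IH by (simp add: numeral_2_eq_2 power_add mult_ac)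
  finally show ?case by (simp add: d Q_def)
qed (simp add: numeral_2_eq_2)

text \<open>The exponent 1 + s - r is -1 here, so the sign and the quadratic power of q cancel
  against those in \<open>qpoch_inverse_power\<close>. A q-binomial coefficient is left.\<close>

lemma basic_hypergeometric_3_1_at_power:
  "basic_hypergeometric [A, B, inverse (of_real (q ^ m))] [C] q (of_real (q ^ m) * y)
     = (\<Sum>j\<le>m. qpoch A q j * qpoch B q j * qpoch (of_real q) q m
          / (qpoch C q j * qpoch (of_real q) q j * qpoch (of_real q) q (m - j)) * y ^ j)"
proof -
  define Q where "Q = complex_of_real q"
  have Q: "Q \<noteq> 0" using q by (simp add: Q_def)
  let ?f = "\<lambda>j. qpochs [A, B, inverse (of_real (q ^ m))] q j / qpochs ([C] @ [of_real q]) q j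
          * ((-1) ^ j * of_real q ^ (j choose 2)) powi (1 + int (length [C]) - int (length [A, B, inverse (Q ^ m)]))
          * (of_real (q ^ m) * y) ^ j"
  have "basic_hypergeometric [A, B, inverse (of_real (q ^ m))] [C] q (of_real (q ^ m) * y) = (\<Sum>j. ?f j)"
    by (simp add: basic_hypergeometric_def)
  also have "\<dots> = (\<Sum>j\<le>m. ?f j)"
  proof (rule suminf_finite)
    fix j assume "j \<notin> {..m}"
    hence "m < j" by simp
    \<comment> \<open>The factor of index \<open>m\<close> is 0.\<close>
    hence "qpoch (inverse (Q ^ m)) q j = 0"
      unfolding qpoch_def using Q by (intro prod_zero bexI[of _ m]) (auto simp: Q_def)
    thus "?f j = 0" by (simp add: qpochs_def Q_def)
  qed simp
  also have "\<dots> = (\<Sum>j\<le>m. qpoch A q j * qpoch B q j * qpoch (of_real q) q m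
          / (qpoch C q j * qpoch (of_real q) q j * qpoch (of_real q) q (m - j)) * y ^ j)"
  proof (rule sum.cong[OF refl])
    fix j assume j: "j \<in> {..m}"
    define u where "u = (-1) ^ j * Q ^ (j choose 2)"
    have u: "u \<noteq> 0" using Q by (simp add: u_def)
    have nz: "qpoch Q q (m - j) \<noteq> 0"
      unfolding Q_def by (intro qpoch_nonzero q_mult_power_ne_1)
    have "qpoch (inverse (Q ^ m)) q j * qpoch Q q (m - j) * (Q ^ m) ^ j = qpoch Q q m * u"
      using qpoch_inverse_power[of j m] j by (simp add: Q_def u_def)
    hence *: "qpoch (inverse (Q ^ m)) q j * (Q ^ m) ^ j / u = qpoch Q q m / qpoch Q q (m - j)"
      using nz u by (simp add: field_simps)
    have "?f j = qpoch A q j * qpoch B q j / (qpoch C q j * qpoch Q q j) *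
             (qpoch (inverse (Q ^ m)) q j * (Q ^ m) ^ j / u) * y ^ j"
      by (simp add: qpochs_def power_int_minus Q_def[symmetric] u_def[symmetric]
            power_mult_distrib divide_inverse mult_ac)
    thus "?f j = qpoch A q j * qpoch B q j * qpoch (of_real q) q m
          / (qpoch C q j * qpoch (of_real q) q j * qpoch (of_real q) q (m - j)) * y ^ j"
      unfolding * by (simp add: Q_def)
  qed
  finally show ?thesis .
qed

section \<open>The generating function of the lattice weights\<close>

text \<open>With s = q^(\<nu>+n) this is the moment of order n up to normalization. The quotient of
  infinite products contributes (C;q)_m / (q;q)_m, whose denominator cancels the numerator of the
  q-binomial coefficient, and the sum over j and i = m - j becomes iterable.\<close>

lemma has_sum_q_hyp_kernel:
  assumes C: "C = A * B * y" "norm C < 1" and s: "norm s < 1" and ys: "norm (y * s) < 1"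
  shows "((\<lambda>m. s ^ m * (qpoch_inf (of_real (q ^ m) * of_real q) q / qpoch_inf (of_real (q ^ m) * C) q
              * basic_hypergeometric [A, B, inverse (of_real (q ^ m))] [C] q (of_real (q ^ m) * y)))
          has_sum (qpoch_inf (of_real q) q * qpoch_inf (A * y * s) q * qpoch_inf (B * y * s) q
                    / (qpoch_inf C q * qpoch_inf s q * qpoch_inf (y * s) q))) UNIV"
proof -
  define Q where "Q = complex_of_real q"
  have Qne: "qpoch Q q n \<noteq> 0" for n
    unfolding Q_def by (intro qpoch_nonzero q_mult_power_ne_1)
  have C_ne: "C * of_real q ^ j \<noteq> 1" for j by (intro mult_power_ne_1 C)
  have Cne: "qpoch C q n \<noteq> 0" for n by (intro qpoch_nonzero C_ne)
  have Cne': "qpoch_inf C q \<noteq> 0" by (intro qpoch_inf_nonzero C_ne)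
  have Cs: "norm (C * s) < 1"
    using mult_strict_mono'[OF C(2) s] by (simp add: norm_mult)
  have Cs_eq: "A * B * (y * s) = C * s" by (simp add: C mult_ac)
  have Cs_ne: "C * s * of_real q ^ j \<noteq> 1" for j by (intro mult_power_ne_1 Cs)
  \<comment> \<open>The summand in the coordinates j and i = m - j, without the constant
    \<open>qpoch_inf Q q / qpoch_inf C q\<close>.\<close>
  define f where "f = (\<lambda>(j, i). qpoch A q j * qpoch B q j / (qpoch C q j * qpoch Q q j)
      * (qpoch C q (j + i) / qpoch Q q i) * (y * s) ^ j * s ^ i)"
  have f_summable: "f summable_on UNIV"
  proof -
    obtain MA where MA: "MA > 0" "\<And>n. norm (qpoch A q n) \<le> MA" using qpoch_bounded by blast
    obtain MB where MB: "MB > 0" "\<And>n. norm (qpoch B q n) \<le> MB" using qpoch_bounded by blast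
    obtain MC where MC: "MC > 0" "\<And>n. norm (qpoch C q n) \<le> MC" using qpoch_bounded by blast
    obtain NQ where NQ: "NQ > 0" "\<And>n. norm (inverse (qpoch Q q n)) \<le> NQ"
      unfolding Q_def using inverse_qpoch_bounded[OF q_mult_power_ne_1] by blast
    obtain NC where NC: "NC > 0" "\<And>n. norm (inverse (qpoch C q n)) \<le> NC"
      using inverse_qpoch_bounded[OF C_ne] by blast
    define K where "K = MA * MB * (NC * NQ) * (MC * NQ)"
    have "norm (f (j, i)) \<le> K * (norm (y * s) ^ j * norm s ^ i)" for i j
    proof -
      have "norm (f (j, i)) = norm (qpoch A q j) * norm (qpoch B q j)
          * (norm (inverse (qpoch C q j)) * norm (inverse (qpoch Q q j)))
          * (norm (qpoch C q (j + i)) * norm (inverse (qpoch Q q i))) * (norm (y * s) ^ j * norm s ^ i)"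
        by (simp add: f_def norm_mult norm_divide norm_power norm_inverse divide_inverse mult_ac)
      also have "\<dots> \<le> K * (norm (y * s) ^ j * norm s ^ i)"
        unfolding K_def using MA MB MC NQ NC
        by (intro mult_right_mono mult_mono mult_nonneg_nonneg) (auto intro: less_imp_le)
      finally show ?thesis .
    qed
    moreover have "(\<lambda>(j, i). K * (norm (y * s) ^ j * norm s ^ i)) summable_on UNIV"
      using summable_on_cmult_right[OF summable_on_geometric_Times[of "norm (y * s)" "norm s"], of K] s ys
      by (simp add: case_prod_unfold)
    ultimately have "(\<lambda>x. norm (f x)) summable_on UNIV"
      by (intro Infinite_Sum.abs_summable_on_comparison_test') auto
    thus ?thesis by (rule abs_summable_summable)
  qed
  define T where "T = qpoch_inf (C * s) q / qpoch_inf s q *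
    (qpoch_inf (A * (y * s)) q * qpoch_inf (B * (y * s)) q / (qpoch_inf (C * s) q * qpoch_inf (y * s) q))"
  have "(f has_sum T) (UNIV \<times> UNIV)"
  proof (rule has_sum_SigmaI)
    fix j
    have "((\<lambda>i. qpoch A q j * qpoch B q j / qpoch Q q j * (y * s) ^ j
             * (qpoch (C * Q ^ j) q i / qpoch Q q i * s ^ i)) has_sum
            (qpoch A q j * qpoch B q j / qpoch Q q j * (y * s) ^ j
             * (qpoch_inf (C * Q ^ j * s) q / qpoch_inf s q))) UNIV"
      unfolding Q_def by (intro has_sum_cmult_right q_binomial_theorem s)
    \<comment> \<open>The inner sum depends on \<open>j\<close> through this product, which supplies
      the denominator \<open>qpoch (C * s) q j\<close> of the Gauss summand. The factor
      \<open>qpoch C q j\<close> cancels against the splitting of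
      \<open>qpoch C q (j + i)\<close>.\<close>
    moreover have "qpoch_inf (C * Q ^ j * s) q = qpoch_inf (C * s) q / qpoch (C * s) q j"
      using qpoch_inf_split[of "C * s" j] qpoch_nonzero[OF Cs_ne, of j]
      by (simp add: Q_def mult_ac)
    moreover have "gauss_term A B (y * s) j
        = qpoch A q j * qpoch B q j / (qpoch Q q j * qpoch (C * s) q j) * (y * s) ^ j"
      by (simp only: gauss_term_def Cs_eq Q_def)
    ultimately show "((\<lambda>i. f (j, i)) has_sum
        (qpoch_inf (C * s) q / qpoch_inf s q * gauss_term A B (y * s) j)) UNIV"
      using Cne[of j]
      by (simp add: f_def qpoch_add Q_def mult_ac)
  next
    show "((\<lambda>j. qpoch_inf (C * s) q / qpoch_inf s q * gauss_term A B (y * s) j) has_sum T) UNIV"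
      unfolding T_def using q_gauss_sum[OF ys, of A B] Cs_ne
      by (intro has_sum_cmult_right) (simp add: Cs_eq)
  qed (use f_summable in simp)
  \<comment> \<open>Regrouping along the diagonals j + i = m returns to lattice points.\<close>
  hence "((\<lambda>(m, j). f (j, m - j)) has_sum T) (SIGMA m:UNIV. {..m})"
    by (subst has_sum_reindex_bij_witness[where i = "\<lambda>(j, i). (j + i, j)" and j = "\<lambda>(m, j). (j, m - j)"
          and T = "UNIV \<times> UNIV" and h = f]) auto
  hence "((\<lambda>m. \<Sum>j\<le>m. f (j, m - j)) has_sum T) UNIV"
    by (rule has_sum_SigmaD) (simp add: has_sum_finite)
  hence "((\<lambda>m. qpoch_inf Q q / qpoch_inf C q * (\<Sum>j\<le>m. f (j, m - j))) has_sum (qpoch_inf Q q / qpoch_inf C q * T)) UNIV"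
    by (rule has_sum_cmult_right)
  moreover have "qpoch_inf Q q / qpoch_inf C q * (\<Sum>j\<le>m. f (j, m - j)) =
      s ^ m * (qpoch_inf (of_real (q ^ m) * of_real q) q / qpoch_inf (of_real (q ^ m) * C) q
              * basic_hypergeometric [A, B, inverse (of_real (q ^ m))] [C] q (of_real (q ^ m) * y))" for m
  proof -
    have 1: "qpoch_inf (Q ^ m * Q) q = qpoch_inf Q q / qpoch Q q m"
      using qpoch_inf_split[of Q m] Qne[of m] by (simp add: Q_def mult_ac)
    have 2: "qpoch_inf (Q ^ m * C) q = qpoch_inf C q / qpoch C q m"
      using qpoch_inf_split[of C m] Cne[of m] by (simp add: Q_def mult_ac)
    have "(\<Sum>j\<le>m. f (j, m - j)) = (\<Sum>j\<le>m. s ^ m * (qpoch C q m / qpoch Q q m)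
        * (qpoch A q j * qpoch B q j * qpoch Q q m / (qpoch C q j * qpoch Q q j * qpoch Q q (m - j)) * y ^ j))"
    proof (rule sum.cong[OF refl])
      fix j assume "j \<in> {..m}"
      hence "s ^ m = s ^ j * s ^ (m - j)" by (simp flip: power_add)
      thus "f (j, m - j) = s ^ m * (qpoch C q m / qpoch Q q m)
        * (qpoch A q j * qpoch B q j * qpoch Q q m / (qpoch C q j * qpoch Q q j * qpoch Q q (m - j)) * y ^ j)"
        using \<open>j \<in> {..m}\<close> Qne[of m] by (simp add: f_def power_mult_distrib mult_ac)
    qed
    thus ?thesis
      unfolding basic_hypergeometric_3_1_at_power
      using 1 2 Cne' Qne[of m] by (simp add: Q_def sum_distrib_left mult_ac)
  qed
  moreover have "qpoch_inf Q q / qpoch_inf C q * T = qpoch_inf Q q * qpoch_inf (A * y * s) q * qpoch_inf (B * y * s) q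
                    / (qpoch_inf C q * qpoch_inf s q * qpoch_inf (y * s) q)"
    using qpoch_inf_nonzero[OF Cs_ne] by (simp add: T_def mult_ac)
  ultimately show ?thesis by (simp add: Q_def)
qed

section \<open>Moments of the one-dimensional measure\<close>

lemma norm_powr_less_1: "0 < Re x \<Longrightarrow> norm (of_real q powr x) < 1"
  using q powr_less_mono'[of q 0 "Re x"] by (simp add: norm_powr_real_powr)

text \<open>The base is a positive real, so its principal logarithm is real and no branch correction
  arises.\<close>

lemma of_real_power_powr: "of_real (q ^ m) powr (x :: complex) = (of_real q powr x) ^ m"
proof -
  have "Ln (of_real (q ^ m)) = of_nat m * of_real (ln q)"
    using q by (simp add: Ln_of_real ln_realpow del: of_real_power)
  thus ?thesis
    using q by (simp add: powr_def Ln_of_real mult_ac flip: exp_of_nat_mult)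
qed

text \<open>The additional factor \<open>1 - q\<close> comes from the q-integral. The assumption
  balances the exponents of 1 - q, so all these powers cancel, and one factor (q;q)_\<infinity>
  survives in the denominator.\<close>

lemma q_Gamma_normalization:
  assumes "\<gamma> + \<eta> = \<nu> + g + l"
  shows "q_Gamma q \<gamma> * q_Gamma q \<eta> / (q_Gamma q \<nu> * q_Gamma q g * q_Gamma q l) * of_real (1 - q)
       = qpoch_inf (of_real q powr \<nu>) q * qpoch_inf (of_real q powr g) q * qpoch_inf (of_real q powr l) q
         / (qpoch_inf (of_real q) q * qpoch_inf (of_real q powr \<gamma>) q * qpoch_inf (of_real q powr \<eta>) q)"
proof -
  define P where "P = complex_of_real (1 - q)"
  have P: "P \<noteq> 0" using q by (simp add: P_def)
  have "P powr (1 - \<gamma>) * P powr (1 - \<eta>) * P powr 1 = P powr (1 - \<nu>) * P powr (1 - g) * P powr (1 - l)"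
    unfolding powr_add[symmetric] using assms by (intro arg_cong[where f = "(powr) P"]) (simp add: algebra_simps)
  hence pw: "P powr (1 - \<gamma>) * P powr (1 - \<eta>) * P = P powr (1 - \<nu>) * P powr (1 - g) * P powr (1 - l)"
    using P by simp
  have Qne: "qpoch_inf (of_real q) q \<noteq> 0"
    by (intro qpoch_inf_nonzero q_mult_power_ne_1)
  let ?Q = "qpoch_inf (of_real q) q" and ?R = "\<lambda>x. qpoch_inf (of_real q powr x) q"
  have "q_Gamma q \<gamma> * q_Gamma q \<eta> / (q_Gamma q \<nu> * q_Gamma q g * q_Gamma q l) * of_real (1 - q)
      = ?Q * ?Q / (?R \<gamma> * ?R \<eta>) * (?R \<nu> * ?R g * ?R l / (?Q * ?Q * ?Q)) *
        (P powr (1 - \<gamma>) * P powr (1 - \<eta>) * P / (P powr (1 - \<nu>) * P powr (1 - g) * P powr (1 - l)))"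
    unfolding q_Gamma_def P_def[symmetric] by (simp add: divide_inverse mult_ac)
  also have "\<dots> = ?R \<nu> * ?R g * ?R l / (?Q * ?R \<gamma> * ?R \<eta>)"
    unfolding pw using Qne P by (simp add: mult_ac)
  finally show ?thesis .
qed

text \<open>The weights 1 - q and t = q^m of the q-integral are included. The case n = 0 says that
  the measure has total mass 1.\<close>

lemma has_sum_q_hyp_density:
  assumes pos: "0 < Re \<nu>" "0 < Re l" "0 < Re (\<gamma> + \<eta> - l - \<nu>)"
    and \<gamma>: "\<And>j. of_real q powr \<gamma> * of_real q ^ j \<noteq> 1"
    and \<eta>: "\<And>j. of_real q powr \<eta> * of_real q ^ j \<noteq> 1"
  shows "((\<lambda>m. of_real (1 - q) * q_hyp_density (\<eta> - l) (\<gamma> - l) (\<gamma> - l + \<eta> - \<nu>) \<nu> q (q ^ m)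
              * of_real (q ^ m) * of_real (q ^ m) ^ n)
          has_sum (qpochs [of_real q powr \<nu>, of_real q powr l] q n
                   / qpochs [of_real q powr \<gamma>, of_real q powr \<eta>] q n)) UNIV"
proof -
  define Q where "Q = complex_of_real q"
  have Q: "Q \<noteq> 0" using q by (simp add: Q_def)
  define g where "g = \<gamma> - l + \<eta> - \<nu>"
  define A where "A = Q powr (\<eta> - l)"
  define B where "B = Q powr (\<gamma> - l)"
  define C where "C = Q powr g"
  define y where "y = Q powr (g - (\<eta> - l) - (\<gamma> - l))"
  \<comment> \<open>At t = q^m the product of t^(\<nu>-1), the weight t and t^n is
    \<open>s ^ m\<close>. Since \<open>y\<close> is q^(l-\<nu>), the three positivity assumptions
    give the bounds on \<open>s\<close>, \<open>y * s\<close> and \<open>C\<close> that the kernel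
    lemma requires.\<close>
  define s where "s = Q powr \<nu> * Q ^ n"
  define k where "k = q_Gamma q \<gamma> * q_Gamma q \<eta> / (q_Gamma q \<nu> * q_Gamma q g * q_Gamma q l) * of_real (1 - q)"
  have C_eq: "C = A * B * y"
    unfolding A_def B_def C_def y_def powr_add[symmetric] by (simp add: algebra_simps)
  have ys: "y * s = Q powr l * Q ^ n" "A * y * s = Q powr \<eta> * Q ^ n" "B * y * s = Q powr \<gamma> * Q ^ n"
    unfolding A_def B_def y_def s_def mult.assoc[symmetric] powr_add[symmetric]
    by (simp_all add: g_def algebra_simps)
  have small: "norm (Q powr x * Q ^ n) < 1" if "0 < Re x" for x
  proof -
    have "norm (Q powr x) * q ^ n \<le> norm (Q powr x) * 1"
      using q by (intro mult_left_mono power_le_one) auto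
    also have "\<dots> < 1" using norm_powr_less_1[OF that] by (simp add: Q_def)
    finally show ?thesis using q by (simp add: Q_def norm_mult norm_power)
  qed
  have g: "0 < Re g" using pos by (simp add: g_def algebra_simps)
  \<comment> \<open>Dividing the shifted infinite products by those in \<open>k\<close> leaves
    exactly the symbols of length \<open>n\<close>.\<close>
  have R: "qpoch_inf (Q powr x) q = qpoch (Q powr x) q n * qpoch_inf (Q powr x * Q ^ n) q" for x
    unfolding Q_def by (rule qpoch_inf_split)
  have R_ne: "qpoch_inf (Q powr x) q \<noteq> 0" if "0 < Re x" for x
    unfolding Q_def by (intro qpoch_inf_nonzero mult_power_ne_1 norm_powr_less_1 that)
  have R_\<gamma>: "qpoch_inf (Q powr \<gamma>) q \<noteq> 0" unfolding Q_def by (intro qpoch_inf_nonzero \<gamma>)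
  have R_\<eta>: "qpoch_inf (Q powr \<eta>) q \<noteq> 0" unfolding Q_def by (intro qpoch_inf_nonzero \<eta>)
  have Q_ne: "qpoch_inf Q q \<noteq> 0"
    unfolding Q_def by (intro qpoch_inf_nonzero q_mult_power_ne_1)
  have "((\<lambda>m. k * (s ^ m * (qpoch_inf (of_real (q ^ m) * of_real q) q / qpoch_inf (of_real (q ^ m) * C) q
              * basic_hypergeometric [A, B, inverse (of_real (q ^ m))] [C] q (of_real (q ^ m) * y))))
          has_sum (k * (qpoch_inf (of_real q) q * qpoch_inf (A * y * s) q * qpoch_inf (B * y * s) q
                    / (qpoch_inf C q * qpoch_inf s q * qpoch_inf (y * s) q)))) UNIV"
    using pos g small unfolding ys
    by (intro has_sum_cmult_right has_sum_q_hyp_kernel[of C A B y s, unfolded ys] C_eq)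
       (auto simp: C_def s_def Q_def intro!: norm_powr_less_1)
  moreover have "k * (qpoch_inf (of_real q) q * qpoch_inf (A * y * s) q * qpoch_inf (B * y * s) q
                    / (qpoch_inf C q * qpoch_inf s q * qpoch_inf (y * s) q))
      = qpochs [Q powr \<nu>, Q powr l] q n / qpochs [Q powr \<gamma>, Q powr \<eta>] q n"
  proof -
    have k: "k = qpoch_inf (Q powr \<nu>) q * qpoch_inf C q * qpoch_inf (Q powr l) q
         / (qpoch_inf Q q * qpoch_inf (Q powr \<gamma>) q * qpoch_inf (Q powr \<eta>) q)"
      unfolding k_def C_def Q_def by (rule q_Gamma_normalization) (simp add: g_def)
    show ?thesis
      unfolding k ys unfolding s_def Q_def[symmetric]
      using R_ne[OF pos(1)] R_ne[OF pos(2)] R_ne[OF g] R_\<gamma> R_\<eta> Q_ne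
      unfolding R[of \<nu>] R[of l] R[of \<gamma>] R[of \<eta>] C_def
      by (simp add: qpochs_def mult_ac)
  qed
  moreover have "k * (s ^ m * (qpoch_inf (of_real (q ^ m) * of_real q) q / qpoch_inf (of_real (q ^ m) * C) q
              * basic_hypergeometric [A, B, inverse (of_real (q ^ m))] [C] q (of_real (q ^ m) * y)))
      = of_real (1 - q) * q_hyp_density (\<eta> - l) (\<gamma> - l) (\<gamma> - l + \<eta> - \<nu>) \<nu> q (q ^ m)
              * of_real (q ^ m) * of_real (q ^ m) ^ n" for m
  proof -
    have "of_real (q ^ m) powr (\<nu> - 1) * Q ^ m = (Q powr (\<nu> - 1) * Q powr 1) ^ m"
      using Q by (simp add: of_real_power_powr power_mult_distrib Q_def del: of_real_power)
    also have "\<dots> = (Q powr \<nu>) ^ m" unfolding powr_add[symmetric] by simp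
    finally have "s ^ m = of_real (q ^ m) powr (\<nu> - 1) * of_real (q ^ m) * of_real (q ^ m) ^ n"
      by (simp add: s_def power_mult_distrib Q_def mult.commute flip: power_mult)
    moreover have "\<nu> + g - (\<eta> - l) = \<gamma>" "\<nu> + g - (\<gamma> - l) = \<eta>" "\<nu> + g - (\<eta> - l) - (\<gamma> - l) = l"
      by (simp_all add: g_def)
    ultimately show ?thesis
      unfolding q_hyp_density_def g_def[symmetric] k_def
      by (simp add: A_def B_def C_def y_def Q_def mult_ac)
  qed
  ultimately show ?thesis by (simp add: Q_def)
qed

end

section \<open>Products of one-dimensional sums\<close>

text \<open>For nonnegative terms it suffices to bound finite partial sums. A finite set of
  functions lies in the box of its coordinate projections, and the sum over that box
  factorizes.\<close>

lemma summable_on_prod_PiE: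
  fixes f :: "'a \<Rightarrow> 'b \<Rightarrow> real"
  assumes "finite A" "\<And>x. x \<in> A \<Longrightarrow> f x summable_on B x" "\<And>x y. x \<in> A \<Longrightarrow> y \<in> B x \<Longrightarrow> 0 \<le> f x y"
  shows "(\<lambda>g. \<Prod>x\<in>A. f x (g x)) summable_on PiE A B"
proof (rule nonneg_bdd_above_summable_on)
  show "0 \<le> (\<Prod>x\<in>A. f x (g x))" if "g \<in> PiE A B" for g
    using that assms(3) by (intro prod_nonneg) (auto simp: PiE_def Pi_def)
  show "bdd_above (sum (\<lambda>g. \<Prod>x\<in>A. f x (g x)) ` {F. F \<subseteq> PiE A B \<and> finite F})"
  proof (rule bdd_aboveI2)
    fix F assume F: "F \<in> {F. F \<subseteq> PiE A B \<and> finite F}"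
    define P where "P x = (\<lambda>g. g x) ` F" for x
    have P: "finite (P x)" "x \<in> A \<Longrightarrow> P x \<subseteq> B x" for x
      using F by (auto simp: P_def)
    have "(\<Sum>g\<in>F. \<Prod>x\<in>A. f x (g x)) \<le> (\<Sum>g\<in>PiE A P. \<Prod>x\<in>A. f x (g x))"
    proof (rule sum_mono2)
      show "finite (PiE A P)" using assms(1) P by (intro finite_PiE)
      show "F \<subseteq> PiE A P" using F by (auto simp: P_def PiE_def)
      show "0 \<le> (\<Prod>x\<in>A. f x (g x))" if "g \<in> PiE A P - F" for g
      proof (intro prod_nonneg ballI assms(3))
        fix x assume "x \<in> A"
        thus "g x \<in> B x" using that P(2)[of x] PiE_mem[of g A P x] by blast
      qed
    qed
    also have "\<dots> = (\<Prod>x\<in>A. \<Sum>y\<in>P x. f x y)"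
      using assms(1) P by (intro prod_sum_PiE[symmetric])
    also have "\<dots> \<le> (\<Prod>x\<in>A. infsum (f x) (B x))"
      using P assms by (intro prod_mono conjI sum_nonneg finite_sum_le_infsum)
        (auto intro!: assms(3)[OF _ subsetD[OF P(2)]])
    finally show "(\<Sum>g\<in>F. \<Prod>x\<in>A. f x (g x)) \<le> (\<Prod>x\<in>A. infsum (f x) (B x))" .
  qed
qed

lemma summable_on_prod_norm:
  fixes f :: "'k::finite \<Rightarrow> 'b \<Rightarrow> complex"
  assumes "\<And>x. f x summable_on UNIV"
  shows "(\<lambda>g. \<Prod>x\<in>UNIV. norm (f x (g x))) summable_on UNIV"
  using summable_on_prod_PiE[of UNIV "\<lambda>x y. norm (f x y)" "\<lambda>_. UNIV"] assms
  by (simp add: summable_on_iff_abs_summable_on_complex)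

lemma has_sum_prod:
  fixes f :: "'k::finite \<Rightarrow> 'b \<Rightarrow> complex"
  assumes "\<And>x. (f x has_sum S x) UNIV"
  shows "((\<lambda>g. \<Prod>x\<in>UNIV. f x (g x)) has_sum (\<Prod>x\<in>UNIV. S x)) UNIV"
proof -
  have f: "f x summable_on UNIV" for x using assms by (rule has_sum_imp_summable)
  have "(\<lambda>g. norm (\<Prod>x\<in>UNIV. f x (g x))) summable_on UNIV"
    using summable_on_prod_norm[OF f] by (simp add: prod_norm)
  hence "(\<lambda>g. \<Prod>x\<in>UNIV. f x (g x)) summable_on UNIV" by (rule abs_summable_summable)
  moreover have "infsum (\<lambda>g. \<Prod>x\<in>UNIV. f x (g x)) UNIV = (\<Prod>x\<in>UNIV. S x)"
    using infsum_prod_PiE_abs[of UNIV f "\<lambda>_. UNIV"] f infsumI[OF assms]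
    by (simp add: summable_on_iff_abs_summable_on_complex)
  ultimately show ?thesis by (metis has_sum_infsum)
qed

lemma mult_power_ne_1_if_not_powi:
  assumes "q \<noteq> 0" "a \<notin> {of_real q powi (- int n) | n. True}"
  shows "a * of_real q ^ j \<noteq> (1 :: complex)"
proof
  assume "a * of_real q ^ j = 1"
  hence "a = of_real q powi (- int j)"
    using assms(1) by (simp add: power_int_minus field_simps)
  thus False using assms(2) by blast
qed

section \<open>Termwise integration over the k-dimensional lattice\<close>

theorem theorem4p1:
  fixes q :: real
    and c :: "('k::finite \<Rightarrow> nat) \<Rightarrow> complex"
    and D :: "(complex ^ 'k) set"
    and z :: "complex ^ 'k"
    and \<gamma> \<eta> lam \<nu> :: "'k \<Rightarrow> complex"
  assumes q: "0 < q" "q < 1"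
    and region: "open D" "connected D"
    and abs_conv: "\<And>w. w \<in> D \<Longrightarrow> (\<lambda>n. norm (power_series_term c w n)) summable_on UNIV"
    and unif_conv: "uniform_limit D (\<lambda>F w. \<Sum>n\<in>F. power_series_term c w n) (power_series c)
                      (finite_subsets_at_top UNIV)"
    and z: "z \<in> D"
    and pos: "\<And>j. Min {Re (\<nu> j), Re (lam j), Re (\<gamma> j + \<eta> j - lam j - \<nu> j)} > 0"
    and \<gamma>: "\<And>j. of_real q powr \<gamma> j \<notin> {of_real q powi (- int n) | n. True}"
    and \<eta>: "\<And>j. of_real q powr \<eta> j \<notin> {of_real q powi (- int n) | n. True}"
  defines "lhs_term \<equiv> \<lambda>n. c n * (\<Prod>j\<in>UNIV.
              qpochs [of_real q powr \<nu> j, of_real q powr lam j] q (n j)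
              / qpochs [of_real q powr \<gamma> j, of_real q powr \<eta> j] q (n j) * (z $ j) ^ n j)"
    and "integrand \<equiv> \<lambda>t :: real ^ 'k. power_series c (\<chi> j. z $ j * of_real (t $ j))
              * (\<Prod>j\<in>UNIV. q_hyp_density (\<eta> j - lam j) (\<gamma> j - lam j)
                             (\<gamma> j - lam j + \<eta> j - \<nu> j) (\<nu> j) q (t $ j))"
  shows "lhs_term summable_on UNIV \<and> q_integrable q integrand
       \<and> (\<Sum>\<^sub>\<infinity>n. lhs_term n) = q_integral q integrand"
proof -
  define dens where "dens j = q_hyp_density (\<eta> j - lam j) (\<gamma> j - lam j) (\<gamma> j - lam j + \<eta> j - \<nu> j) (\<nu> j) q" for j
  \<comment> \<open>The full weight of the lattice point q^m in coordinate \<open>j\<close>.\<close>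
  define W where "W j m = of_real (1 - q) * dens j (q ^ m) * of_real (q ^ m)" for j m
  define r where "r j n = qpochs [of_real q powr \<nu> j, of_real q powr lam j] q n
              / qpochs [of_real q powr \<gamma> j, of_real q powr \<eta> j] q n" for j n
  have moment: "((\<lambda>m. W j m * of_real (q ^ m) ^ n) has_sum r j n) UNIV" for j n
    unfolding W_def r_def dens_def using pos[of j] q
    by (intro has_sum_q_hyp_density q mult_power_ne_1_if_not_powi \<gamma> \<eta>) auto
  \<comment> \<open>The moment of order 0 provides summability of the weights themselves, which for
    complex families is absolute.\<close>
  have W: "W j summable_on UNIV" for j
    using has_sum_imp_summable[OF moment[of j 0]] by simp
  \<comment> \<open>Summing over \<open>m\<close> first gives \<open>lhs_term\<close>; summing over
    \<open>n\<close> first gives the terms of the q-integral. Joint absolute summability makes the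
    two totals agree.\<close>
  define f where "f = (\<lambda>(n, m). power_series_term c z n * (\<Prod>j\<in>UNIV. W j (m j) * of_real (q ^ m j) ^ n j))"
  \<comment> \<open>Bounding the lattice powers by 1 separates the majorant into a factor in
    \<open>n\<close> and a factor in \<open>m\<close>.\<close>
  have f_bound: "norm (f (n, m)) \<le> norm (power_series_term c z n) * (\<Prod>j\<in>UNIV. norm (W j (m j)))" for n m
  proof -
    have "norm (W j (m j) * of_real (q ^ m j) ^ n j) \<le> norm (W j (m j)) * 1" for j
      unfolding norm_mult using q
      by (intro mult_left_mono) (auto simp: norm_power intro!: power_le_one)
    thus ?thesis
      unfolding f_def prod.case norm_mult[of "power_series_term c z n"] prod_norm[symmetric]
      by (intro mult_left_mono prod_mono) auto
  qed
  have "(\<lambda>(n, m). norm (power_series_term c z n) * (\<Prod>j\<in>UNIV. norm (W j (m j)))) summable_on (UNIV \<times> UNIV)"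
  proof (rule summable_on_SigmaI)
    show "((\<lambda>m. case (n, m) of (n, m) \<Rightarrow> norm (power_series_term c z n) * (\<Prod>j\<in>UNIV. norm (W j (m j))))
        has_sum (norm (power_series_term c z n) * (\<Sum>\<^sub>\<infinity>m. \<Prod>j\<in>UNIV. norm (W j (m j))))) UNIV" for n
      using summable_on_prod_norm[of W, OF W] by (auto intro: has_sum_cmult_right)
    show "(\<lambda>n. norm (power_series_term c z n) * (\<Sum>\<^sub>\<infinity>m. \<Prod>j\<in>UNIV. norm (W j (m j)))) summable_on UNIV"
      by (intro summable_on_cmult_left abs_conv z)
  qed (auto intro!: mult_nonneg_nonneg prod_nonneg)
  hence "(\<lambda>x. norm (f x)) summable_on (UNIV \<times> UNIV)"
    by (rule Infinite_Sum.abs_summable_on_comparison_test') (use f_bound in auto)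
  hence f: "f summable_on (UNIV \<times> UNIV)" by (rule abs_summable_summable)
  define S where "S = infsum f (UNIV \<times> UNIV)"
  have f_S: "(f has_sum S) (UNIV \<times> UNIV)" unfolding S_def using f by (rule has_sum_infsum)
  have lhs: "(lhs_term has_sum S) UNIV"
  proof (rule has_sum_SigmaD[OF f_S])
    fix n :: "'k \<Rightarrow> nat"
    have "((\<lambda>m. f (n, m)) has_sum (power_series_term c z n * (\<Prod>j\<in>UNIV. r j (n j)))) UNIV"
      unfolding f_def prod.case by (intro has_sum_cmult_right has_sum_prod moment)
    thus "((\<lambda>m. f (n, m)) has_sum lhs_term n) UNIV"
      by (simp add: lhs_term_def power_series_term_def prod.distrib mult_ac flip: r_def)
  qed
  have f': "((\<lambda>(m, n). f (n, m)) has_sum S) (UNIV \<times> UNIV)"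
    using f_S by (subst (asm) has_sum_swap)
  have rhs: "((\<lambda>m. of_real ((1 - q) ^ CARD('k)) * q_integrand_term q integrand m) has_sum S) UNIV"
  proof (rule has_sum_SigmaD[OF f'])
    fix m :: "'k \<Rightarrow> nat"
    let ?z = "\<chi> j. z $ j * of_real (q ^ m j)"
    have f_eq: "f (n, m) = power_series_term c ?z n * (\<Prod>j\<in>UNIV. W j (m j))" for n
      by (simp add: f_def power_series_term_def prod.distrib power_mult_distrib mult_ac)
    \<comment> \<open>The scaled point \<open>?z\<close> need not lie in \<open>D\<close>, so
      convergence there is obtained by comparison with \<open>z\<close>, whose coordinates are at
      least as large in norm.\<close>
    have "(\<lambda>n. norm (power_series_term c ?z n)) summable_on UNIV"
    proof (rule Infinite_Sum.abs_summable_on_comparison_test'[OF abs_conv[OF z]])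
      fix n
      have "norm (z $ j * of_real (q ^ m j)) \<le> norm (z $ j)" for j
        using q by (auto simp: norm_mult norm_power intro!: mult_right_le_one_le power_le_one)
      thus "norm (power_series_term c ?z n) \<le> norm (power_series_term c z n)"
        unfolding power_series_term_def norm_mult[of "c n"] prod_norm[symmetric]
        by (intro mult_left_mono prod_mono) (auto simp: norm_power intro!: power_mono)
    qed
    hence "(power_series_term c ?z has_sum power_series c ?z) UNIV"
      unfolding power_series_def by (rule has_sum_infsum[OF abs_summable_summable])
    hence "((\<lambda>n. f (n, m)) has_sum (power_series c ?z * (\<Prod>j\<in>UNIV. W j (m j)))) UNIV"
      unfolding f_eq by (rule has_sum_cmult_left)
    moreover have "power_series c ?z * (\<Prod>j\<in>UNIV. W j (m j))
        = of_real ((1 - q) ^ CARD('k)) * q_integrand_term q integrand m"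
      by (simp add: q_integrand_term_def integrand_def W_def dens_def prod.distrib power_sum mult_ac)
    ultimately show "((\<lambda>n. case (m, n) of (m, n) \<Rightarrow> f (n, m)) has_sum
        (of_real ((1 - q) ^ CARD('k)) * q_integrand_term q integrand m)) UNIV"
      by simp
  qed
  \<comment> \<open>Removing the nonzero constant gives genuine convergence of the q-integral, which
    the value of an unordered sum with default 0 would not certify.\<close>
  have "complex_of_real ((1 - q) ^ CARD('k)) \<noteq> 0" using q by simp
  hence int: "q_integrand_term q integrand summable_on UNIV"
    using has_sum_imp_summable[OF rhs] by (subst (asm) summable_on_cmult_right') auto
  have "q_integral q integrand = S"
    unfolding q_integral_def using infsumI[OF rhs] int by (simp add: infsum_cmult_right')
  thus ?thesis
    using lhs int infsumI[OF lhs] by (auto simp: q_integrable_def dest: has_sum_imp_summable)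
qed

end
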